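(* Let $d\ge 1$ be an integer. For $d=1$, and for $d\ge 2$ under radial symmetry, the wave system $$-\partial_t^2U_1+\Delta U_1+(U_1+U_2)\,Q(U)=0,\qquad -\partial_t^2U_2+\Delta U_2+(U_2-U_1)\,Q(U)=0,$$ $$Q(U)=\sum_{i=1}^{2}\big(-(\partial_tU_i)^2+|\nabla U_i|^2\big),$$ for maps $U=(U_1,U_2)$ with $U_1^2+U_2^2=1$, admits no continuously self-similar blowup solutions. More precisely, there exists no non-constant classical solution $U:\Gamma^-\to\mathbb{S}^1$ of this system on $\Gamma^-$ (radial in $x$ if $d\ge2$) of the form $$U(t,x)=Z\Big(\frac{x}{-t}\Big)$$ for which $Z:\overline{\mathbb{B}^d_1}\to\mathbb{S}^1\subset\mathbb{R}^2$ satisfies $Z\in C^\infty\times C^\infty(\overline{\mathbb{B}^d_1})$.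
   Context: $\mathbb{S}^1\subset\mathbb{R}^2$ is the unit circle. $\mathbb{B}^d_r$ is the open ball in $\mathbb{R}^d$ of radius $r$ centered at $0$. $\Gamma^-:=\{(t,x)\in\mathbb{R}^{1+d}:t<0,\ |x|\le -t\}$ is the backward lightcone of $(0,0)$. $Z\in C^\infty\times C^\infty(\overline{\mathbb{B}^d_1})$ means that both components of $Z$ are smooth up to the boundary. A solution is continuously self-similar if $U(t/\lambda,x/\lambda)=U(t,x)$ for all $\lambda>0$, which on $\Gamma^-$ amounts to the form $U(t,x)=Z(x/(-t))$. Radial means that $U(t,x)$ depends only on $t$ and $|x|$. *)

theory Defs
  imports "HOL-Analysis.Analysis"
begin

(* Derivatives are taken relative to a set S, so that they also make sense at boundary points of S.
   S will only be the closed unit ball or the backward lightcone: both are convex with nonempty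
   interior, so the Frechet derivative within S is unique at every point of S, and it is the
   ordinary one at interior points. *)
definition partial_within ::
  "'a::euclidean_space set \<Rightarrow> 'a \<Rightarrow> ('a \<Rightarrow> real) \<Rightarrow> 'a \<Rightarrow> real" where
  "partial_within S v f x = frechet_derivative f (at x within S) v"

(* For the two kinds of S above this is C^k up to the boundary: f is C^k in the interior and all
   partial derivatives of order at most k extend continuously to S. *)
fun Ck_on :: "nat \<Rightarrow> 'a::euclidean_space set \<Rightarrow> ('a \<Rightarrow> real) \<Rightarrow> bool" where
  "Ck_on 0 S f \<longleftrightarrow> continuous_on S f"
| "Ck_on (Suc k) S f \<longleftrightarrow>
     f differentiable_on S \<and> (\<forall>v\<in>Basis. Ck_on k S (partial_within S v f))"

definition smooth_on :: "'a::euclidean_space set \<Rightarrow> ('a \<Rightarrow> real) \<Rightarrow> bool" where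
  "smooth_on S f \<longleftrightarrow> (\<forall>k. Ck_on k S f)"

definition backward_lightcone :: "(real \<times> (real ^ 'n)) set" where
  "backward_lightcone = {(t, x). t < 0 \<and> norm x \<le> - t}"

definition dt :: "(real \<times> (real ^ 'n) \<Rightarrow> real) \<Rightarrow> real \<times> (real ^ 'n) \<Rightarrow> real" where
  "dt = partial_within backward_lightcone (1, 0)"

definition dx :: "'n \<Rightarrow> (real \<times> (real ^ 'n) \<Rightarrow> real) \<Rightarrow> real \<times> (real ^ 'n) \<Rightarrow> real" where
  "dx j = partial_within backward_lightcone (0, axis j 1)"

definition laplacian :: "(real \<times> (real ^ 'n) \<Rightarrow> real) \<Rightarrow> real \<times> (real ^ 'n) \<Rightarrow> real" where
  "laplacian u p = (\<Sum>j\<in>UNIV. dx j (dx j u) p)"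

definition null_form :: "(real \<times> (real ^ 'n) \<Rightarrow> real ^ 2) \<Rightarrow> real \<times> (real ^ 'n) \<Rightarrow> real" where
  "null_form U p =
     (\<Sum>i\<in>UNIV. - (dt (\<lambda>q. U q $ i) p)\<^sup>2 + (\<Sum>j\<in>UNIV. (dx j (\<lambda>q. U q $ i) p)\<^sup>2))"

definition classical_solution :: "(real \<times> (real ^ 'n) \<Rightarrow> real ^ 2) \<Rightarrow> bool" where
  "classical_solution U \<longleftrightarrow>
     (\<forall>i. Ck_on 2 backward_lightcone (\<lambda>p. U p $ i)) \<and>
     (\<forall>p\<in>backward_lightcone.
        U p \<in> sphere 0 1 \<and>
        - dt (dt (\<lambda>q. U q $ 1)) p + laplacian (\<lambda>q. U q $ 1) p
          + (U p $ 1 + U p $ 2) * null_form U p = 0 \<and>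
        - dt (dt (\<lambda>q. U q $ 2)) p + laplacian (\<lambda>q. U q $ 2) p
          + (U p $ 2 - U p $ 1) * null_form U p = 0)"

definition radial :: "(real \<times> (real ^ 'n) \<Rightarrow> real ^ 2) \<Rightarrow> bool" where
  "radial U \<longleftrightarrow>
     (\<forall>t x y. (t, x) \<in> backward_lightcone \<longrightarrow> (t, y) \<in> backward_lightcone \<longrightarrow>
        norm x = norm y \<longrightarrow> U (t, x) = U (t, y))"

end

theory Submission
  imports Defs
begin

text \<open>
  Why only constants survive. Locally \<open>U = (cos \<theta>, sin \<theta>)\<close>, and the system says that the phase
  satisfies \<open>\<box>\<theta> = - (\<partial>\<^sub>t \<theta>)\<^sup>2 + \<bar>\<nabla>\<theta>\<bar>\<^sup>2\<close>, where \<open>\<box> = - \<partial>\<^sub>t\<^sup>2 + \<Delta>\<close>; equivalently, \<open>exp (- \<theta>)\<close> solves the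
  linear wave equation. For a self-similar \<open>U\<close>, radial if \<open>d \<ge> 2\<close>, restricted to the points
  \<open>(-1, s e)\<close> with \<open>e\<close> a coordinate vector, this becomes for the angular velocity \<open>W = \<theta>'\<close> the
  Bernoulli equation
  \<open>s (1 - s\<^sup>2) W' + (d - 1 - 2 s\<^sup>2) W = s (1 - s\<^sup>2) W\<^sup>2\<close>.
  No lift \<open>\<theta>\<close> has to be chosen, because \<open>W = u\<^sub>1 u\<^sub>2' - u\<^sub>2 u\<^sub>1'\<close> in terms of the two components on the ray.

  The weighted velocity \<open>P = s\<^bsup>d-1\<^esup> (1 - s\<^sup>2) W\<close> then satisfies the homogeneous linear equation
  \<open>P' = h P\<close> with \<open>h = W - (d - 1) s / (1 - s\<^sup>2)\<close>, so that one zero of \<open>P\<close> on an interval where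
  \<open>h\<close> is continuous makes it vanish there. Regularity of \<open>U\<close> provides the zero. If \<open>d \<ge> 2\<close>, it lies at
  the centre, where the factor \<open>s\<^bsup>d-1\<^esup>\<close> vanishes and \<open>W\<close> is finite. If \<open>d = 1\<close>, it lies on the light
  cone \<open>\<bar>s\<bar> = 1\<close>, where \<open>1 - s\<^sup>2\<close> vanishes and \<open>W\<close> is finite because \<open>U\<close> is \<open>C\<^sup>1\<close> up to the boundary. So
  \<open>W = 0\<close> (\<open>profile_derivative_eq_0\<close>), and \<open>U\<close> is constant along the ray; radial symmetry, or
  \<open>d = 1\<close>, and self-similarity spread this constant over the whole cone.

  The reduction to the ray (\<open>selfsimilar_profile_equation\<close>) uses one-variable calculus only: there
  \<open>U(t, s e) = u(- s / t)\<close>, and \<open>U(-1, s e + r e') = u(\<surd>(s\<^sup>2 + r\<^sup>2))\<close> for a coordinate vector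
  \<open>e' \<noteq> e\<close> and \<open>s > 0\<close>, and differentiating these twice gives all the second derivatives in the system.
\<close>

section \<open>The profile equation on a ray\<close>

text \<open>
  With an antiderivative \<open>H\<close> of \<open>h\<close>, the product \<open>P exp (- H)\<close> is constant. The equation is asked for in
  the open interval only: the endpoints used below are the centre, where the profile equation degenerates,
  and the light cone, where the profile is known to be merely continuously differentiable from inside.
\<close>
lemma linear_ode_eq_0:
  fixes P h :: "real \<Rightarrow> real"
  assumes P: "continuous_on {a..b} P" and h: "continuous_on {a..b} h"
    and ode: "\<And>s. s \<in> {a<..<b} \<Longrightarrow> (P has_real_derivative h s * P s) (at s)"
    and c: "c \<in> {a..b}" "P c = 0" and s: "s \<in> {a..b}"
  shows "P s = 0"
proof -
  obtain H where H: "\<And>x. x \<in> {a..b} \<Longrightarrow> (H has_vector_derivative h x) (at x within {a..b})"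
    using antiderivative_continuous[OF h] by blast
  have "continuous_on {a..b} H"
    using H by (meson has_vector_derivative_continuous continuous_on_eq_continuous_within)
  then have cont: "continuous_on {a..b} (\<lambda>x. P x * exp (- H x))"
    by (intro continuous_intros P)
  have deriv: "((\<lambda>x. P x * exp (- H x)) has_real_derivative 0) (at x)" if "a < x" "x < b" for x
  proof -
    have "(H has_real_derivative h x) (at x)"
      using H[of x] that at_within_Icc_at[of a x b]
      by (simp add: has_real_derivative_iff_has_vector_derivative)
    with ode[of x] that show ?thesis
      by (auto intro!: derivative_eq_intros)
  qed
  have "P s * exp (- H s) = P c * exp (- H c)"
  proof (cases "a < b")
    case True
    then show ?thesis
      using DERIV_isconst2[OF True cont deriv, of c] DERIV_isconst2[OF True cont deriv, of s] c s
      by auto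
  next
    case False
    then have "s = c" using c s by auto
    then show ?thesis by simp
  qed
  then show ?thesis
    using c by simp
qed

text \<open>
  Here \<open>n = d - 1\<close>, and the two equations are those of the components of \<open>U\<close> on the ray, multiplied by
  \<open>s\<close> to clear the denominator of the radial Laplacian. Subtracting \<open>u\<^sub>2\<close> times the first from \<open>u\<^sub>1\<close> times the second gives the Bernoulli
  equation for the angular velocity \<open>W\<close>. The alternatives for the interval are the two ways of getting a
  zero of \<open>P\<close>: for \<open>n = 0\<close> the interval reaches the light cone; for \<open>n > 0\<close> it reaches the centre but
  must stay away from the light cone, where \<open>h\<close> has a pole.
\<close>
lemma profile_derivative_eq_0:
  fixes u1 u2 v1 v2 w1 w2 :: "real \<Rightarrow> real" and n :: nat
  assumes cont: "continuous_on {a..b} u1" "continuous_on {a..b} u2"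
      "continuous_on {a..b} v1" "continuous_on {a..b} v2"
    and sub: "{a<..<b} \<subseteq> {-1<..<1} - {0}"
    and du: "\<And>s. s \<in> {a<..<b} \<Longrightarrow> (u1 has_real_derivative v1 s) (at s)"
      "\<And>s. s \<in> {a<..<b} \<Longrightarrow> (u2 has_real_derivative v2 s) (at s)"
    and dv: "\<And>s. s \<in> {a<..<b} \<Longrightarrow> (v1 has_real_derivative w1 s) (at s)"
      "\<And>s. s \<in> {a<..<b} \<Longrightarrow> (v2 has_real_derivative w2 s) (at s)"
    and circle: "\<And>s. s \<in> {a<..<b} \<Longrightarrow> (u1 s)\<^sup>2 + (u2 s)\<^sup>2 = 1"
    and ode1: "\<And>s. s \<in> {a<..<b} \<Longrightarrow> s * (1 - s\<^sup>2) * w1 s + (real n - 2 * s\<^sup>2) * v1 s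
        + (u1 s + u2 s) * (s * (1 - s\<^sup>2) * ((v1 s)\<^sup>2 + (v2 s)\<^sup>2)) = 0"
    and ode2: "\<And>s. s \<in> {a<..<b} \<Longrightarrow> s * (1 - s\<^sup>2) * w2 s + (real n - 2 * s\<^sup>2) * v2 s
        + (u2 s - u1 s) * (s * (1 - s\<^sup>2) * ((v1 s)\<^sup>2 + (v2 s)\<^sup>2)) = 0"
    and bdry: "n = 0 \<and> (-1 \<in> {a..b} \<or> 1 \<in> {a..b}) \<or> n > 0 \<and> 0 \<in> {a..b} \<and> -1 < a \<and> b < 1"
    and s: "s \<in> {a<..<b}"
  shows "v1 s = 0 \<and> v2 s = 0"
proof -
  define W where "W s = u1 s * v2 s - u2 s * v1 s" for s
  define P where "P s = s ^ n * (1 - s\<^sup>2) * W s" for s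
  define h where "h s = W s - real n * s / (1 - s\<^sup>2)" for s
  have W: "continuous_on {a..b} W"
    unfolding W_def by (intro continuous_intros cont)
  have P: "continuous_on {a..b} P"
    unfolding P_def by (intro continuous_intros W)
  have h: "continuous_on {a..b} h"
  proof (cases "n = 0")
    case True
    then show ?thesis using W by (simp add: h_def)
  next
    case False
    have "1 - x\<^sup>2 \<noteq> 0" if "x \<in> {a..b}" for x
      using that bdry False abs_square_less_1[of x] by auto
    then show ?thesis
      unfolding h_def by (intro continuous_intros W) auto
  qed
  \<comment> \<open>The velocity is tangent to the circle, so W carries all of it.\<close>
  have tangent: "u1 x * v1 x + u2 x * v2 x = 0" if x: "x \<in> {a<..<b}" for x
  proof -
    have "((\<lambda>x. (u1 x)\<^sup>2 + (u2 x)\<^sup>2) has_real_derivative 2 * (u1 x * v1 x + u2 x * v2 x)) (at x)"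
      using du[OF x] by (auto intro!: derivative_eq_intros simp: algebra_simps)
    moreover have "((\<lambda>x. (u1 x)\<^sup>2 + (u2 x)\<^sup>2) has_real_derivative 0) (at x)"
      by (rule has_field_derivative_transform_within_open[of "\<lambda>x. 1" _ _ "{a<..<b}"])
        (use x circle in auto)
    ultimately show ?thesis
      using DERIV_unique by fastforce
  qed
  have energy: "(v1 x)\<^sup>2 + (v2 x)\<^sup>2 = (W x)\<^sup>2" if x: "x \<in> {a<..<b}" for x
  proof -
    have "(W x)\<^sup>2 + (u1 x * v1 x + u2 x * v2 x)\<^sup>2
        = ((u1 x)\<^sup>2 + (u2 x)\<^sup>2) * ((v1 x)\<^sup>2 + (v2 x)\<^sup>2)"
      by (simp add: W_def power2_eq_square algebra_simps)
    then show ?thesis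
      using tangent[OF x] circle[OF x] by simp
  qed
  have nonsingular: "x \<noteq> 0 \<and> 1 - x\<^sup>2 \<noteq> 0" if "x \<in> {a<..<b}" for x
  proof -
    have "x \<in> {-1<..<1} - {0}" using sub that by blast
    then show ?thesis using abs_square_less_1[of x] by auto
  qed
  have ode: "(P has_real_derivative h x * P x) (at x)" if x: "x \<in> {a<..<b}" for x
  proof -
    define W' where "W' = u1 x * w2 x - u2 x * w1 x"
    have dW: "(W has_real_derivative W') (at x)"
      unfolding W_def using du[OF x] dv[OF x]
      by (auto intro!: derivative_eq_intros simp: W'_def algebra_simps)
    have x0: "x \<noteq> 0" and x1: "1 - x\<^sup>2 \<noteq> 0"
      using nonsingular[OF x] by auto
    define A where "A = real n * x ^ (n - 1) * (1 - x\<^sup>2) * W x - x ^ n * (2 * x) * W x + x ^ n * (1 - x\<^sup>2) * W'"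
    have dP: "(P has_real_derivative A) (at x)"
      unfolding P_def using dW
      by (auto intro!: derivative_eq_intros simp: A_def algebra_simps)
    have "x * (1 - x\<^sup>2) * W' + (real n - 2 * x\<^sup>2) * W x
        = ((u1 x)\<^sup>2 + (u2 x)\<^sup>2) * (x * (1 - x\<^sup>2) * (W x)\<^sup>2)"
      using ode1[OF x] ode2[OF x] unfolding energy[OF x] unfolding W'_def
      by (subst (1) W_def) algebra
    then have Wode: "x * (1 - x\<^sup>2) * W' = x * (1 - x\<^sup>2) * (W x)\<^sup>2 - (real n - 2 * x\<^sup>2) * W x"
      using circle[OF x] by simp
    \<comment> \<open>Multiplying by x restores the power n; the factor n covers the truncated exponent at n = 0.\<close>
    have lower: "real n * x ^ (n - 1) * x = real n * x ^ n"
      by (cases n) auto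
    have "x * A = (real n * x ^ (n - 1) * x) * ((1 - x\<^sup>2) * W x)
        + x ^ n * (x * (1 - x\<^sup>2) * W' - 2 * x\<^sup>2 * W x)"
      by (simp add: A_def power2_eq_square algebra_simps)
    also have "\<dots> = x ^ n * (real n * (1 - x\<^sup>2) * W x - 2 * x\<^sup>2 * W x + x * (1 - x\<^sup>2) * W')"
      unfolding lower by (simp add: algebra_simps)
    also have "\<dots> = x ^ n * (x * (1 - x\<^sup>2) * (W x)\<^sup>2 - real n * x\<^sup>2 * W x)"
      unfolding Wode by (simp add: algebra_simps)
    also have "\<dots> = x * (h x * P x)"
      using x1 by (simp add: h_def P_def field_simps power2_eq_square)
    finally have "A = h x * P x"
      using x0 by simp
    with dP show ?thesis by simp
  qed
  obtain c where c: "c \<in> {a..b}" "P c = 0"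
  proof -
    have "P 1 = 0" "P (-1) = 0" by (auto simp: P_def)
    moreover have "n > 0 \<Longrightarrow> P 0 = 0" by (simp add: P_def)
    ultimately show ?thesis using bdry that by blast
  qed
  have "P s = 0"
    by (rule linear_ode_eq_0[OF P h ode c]) (use s in auto)
  with nonsingular[OF s] have "W s = 0"
    by (simp add: P_def)
  with energy[OF s] show ?thesis
    by (simp add: sum_power2_eq_zero_iff)
qed

section \<open>Derivatives inside the lightcone\<close>

lemma interior_lightconeI:
  assumes "norm x < - t"
  shows "(t, x) \<in> interior backward_lightcone"
proof (rule interiorI)
  show "open {p :: real \<times> (real ^ 'n). norm (snd p) < - fst p}"
    by (intro open_Collect_less continuous_intros)
qed (use assms in \<open>auto simp: backward_lightcone_def dest: order_le_less_trans[OF norm_ge_zero]\<close>)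

text \<open>
  All derivatives of the system are taken relative to the cone. At its interior points they are ordinary
  ones, so that they can be computed by restriction to curves.
\<close>
lemma has_derivative_along_curve:
  fixes g :: "'a::euclidean_space \<Rightarrow> real"
  assumes g: "g differentiable_on S" and c: "(c has_vector_derivative v) (at r)"
    and int: "c r \<in> interior S"
  shows "((\<lambda>r. g (c r)) has_real_derivative partial_within S v g (c r)) (at r)"
proof -
  have "g differentiable (at (c r))"
    using g int by (metis at_within_interior differentiable_on_def interior_subset subsetD)
  then have g': "(g has_derivative frechet_derivative g (at (c r))) (at (c r))"
    by (simp add: frechet_derivative_works)
  have "((\<lambda>r. g (c r)) has_derivative (\<lambda>h. frechet_derivative g (at (c r)) (h *\<^sub>R v))) (at r)"
    using diff_chain_at[OF c[unfolded has_vector_derivative_def] g'] by (simp add: o_def)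
  moreover have "frechet_derivative g (at (c r)) (h *\<^sub>R v) = partial_within S v g (c r) * h" for h
  proof -
    have "frechet_derivative g (at (c r)) (h *\<^sub>R v) = h *\<^sub>R frechet_derivative g (at (c r)) v"
      using has_derivative_linear[OF g'] by (rule linear_scale)
    moreover have "partial_within S v g (c r) = frechet_derivative g (at (c r)) v"
      unfolding partial_within_def at_within_interior[OF int] ..
    ultimately show ?thesis by simp
  qed
  ultimately show ?thesis
    by (simp add: has_field_derivative_def)
qed

lemma dt_has_derivative:
  fixes x :: "real ^ 'n"
  assumes "g differentiable_on backward_lightcone" "norm x < - t"
  shows "((\<lambda>t. g (t, x)) has_real_derivative dt g (t, x)) (at t)"
  unfolding dt_def
  by (rule has_derivative_along_curve)
    (use assms in \<open>auto intro!: derivative_eq_intros interior_lightconeI simp: has_vector_derivative_def\<close>)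

lemma dx_has_derivative:
  fixes x :: "real ^ 'n"
  assumes "g differentiable_on backward_lightcone" "norm (x + r *\<^sub>R axis j 1) < - t"
  shows "((\<lambda>r. g (t, x + r *\<^sub>R axis j 1)) has_real_derivative dx j g (t, x + r *\<^sub>R axis j 1)) (at r)"
  unfolding dx_def
  by (rule has_derivative_along_curve)
    (use assms in \<open>auto intro!: derivative_eq_intros interior_lightconeI simp: has_vector_derivative_def\<close>)

lemma C2_lightcone_D:
  fixes f :: "real \<times> (real ^ 'n) \<Rightarrow> real"
  assumes "Ck_on 2 backward_lightcone f"
  shows "f differentiable_on backward_lightcone"
    "dt f differentiable_on backward_lightcone" "dx j f differentiable_on backward_lightcone"
proof -
  have "(1, 0) \<in> (Basis :: (real \<times> (real ^ 'n)) set)" "(0, axis j 1) \<in> (Basis :: (real \<times> (real ^ 'n)) set)"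
    by (auto simp: Basis_prod_def Basis_vec_def)
  with assms show "f differentiable_on backward_lightcone"
    "dt f differentiable_on backward_lightcone" "dx j f differentiable_on backward_lightcone"
    by (auto simp: eval_nat_numeral dt_def dx_def)
qed

section \<open>Restricting the wave operator to a ray\<close>

text \<open>
  With \<open>u(r) = f(-1, r e\<^sub>k)\<close>, self-similarity reads \<open>f(t, s e\<^sub>k) = u(- s / t)\<close>, hence
  \<open>\<partial>\<^sub>t f(t, s e\<^sub>k) = u'(- s / t) s / t\<^sup>2\<close>; both formulas are this and its derivative at \<open>t = -1\<close>.
\<close>
lemma dt_selfsimilar:
  fixes f :: "real \<times> (real ^ 'n) \<Rightarrow> real" and k :: 'n
  assumes C2: "Ck_on 2 backward_lightcone f"
    and hom: "\<And>t x. (t, x) \<in> backward_lightcone \<Longrightarrow> f (t, x) = f (-1, x /\<^sub>R (- t))"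
    and s: "\<bar>s\<bar> < 1"
  defines "p \<equiv> (-1, s *\<^sub>R axis k 1)"
  shows "dt f p = s * dx k f p"
    and "dt (dt f) p = s\<^sup>2 * dx k (dx k f) p + 2 * s * dx k f p"
proof -
  note D = C2_lightcone_D[OF C2]
  define V where "V r = dx k f (-1, r *\<^sub>R axis k 1)" for r
  have u: "((\<lambda>r. f (-1, r *\<^sub>R axis k 1)) has_real_derivative V r) (at r)" if "\<bar>r\<bar> < 1" for r
    using dx_has_derivative[OF D(1), of 0 r k "-1"] that by (simp add: V_def)
  have V: "(V has_real_derivative dx k (dx k f) (-1, r *\<^sub>R axis k 1)) (at r)" if "\<bar>r\<bar> < 1" for r
    using dx_has_derivative[OF D(3), of 0 r k "-1" k] that by (simp add: V_def[abs_def])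
  have small: "\<bar>- s / t\<bar> < 1" if "t < - \<bar>s\<bar>" for t
    using that by (simp add: field_simps abs_if split: if_splits)
  have dtf: "dt f (t, s *\<^sub>R axis k 1) = V (- s / t) * (s / t\<^sup>2)" if t: "t < - \<bar>s\<bar>" for t
  proof (rule DERIV_unique)
    show "((\<lambda>t. f (t, s *\<^sub>R axis k 1)) has_real_derivative dt f (t, s *\<^sub>R axis k 1)) (at t)"
      using t by (intro dt_has_derivative D) (simp)
    have "((\<lambda>t. - s / t) has_real_derivative s / t\<^sup>2) (at t)"
      using t by (auto intro!: derivative_eq_intros simp: power2_eq_square)
    from DERIV_chain2[OF u[OF small[OF t]] this]
    have "((\<lambda>t. f (-1, (- s / t) *\<^sub>R axis k 1)) has_real_derivative V (- s / t) * (s / t\<^sup>2)) (at t)" .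
    then show "((\<lambda>t. f (t, s *\<^sub>R axis k 1)) has_real_derivative V (- s / t) * (s / t\<^sup>2)) (at t)"
    proof (rule has_field_derivative_transform_within_open[where S = "{..<- \<bar>s\<bar>}"])
      fix r assume r: "r \<in> {..<- \<bar>s\<bar>}"
      then have "(r, s *\<^sub>R axis k 1) \<in> backward_lightcone"
        by (auto simp: backward_lightcone_def)
      then show "f (-1, (- s / r) *\<^sub>R axis k 1) = f (r, s *\<^sub>R axis k 1)"
        by (simp add: hom[of r] divide_inverse mult.commute)
    qed (use t in auto)
  qed
  from dtf[of "-1"] s show "dt f p = s * dx k f p"
    by (simp add: p_def V_def)
  show "dt (dt f) p = s\<^sup>2 * dx k (dx k f) p + 2 * s * dx k f p"
  proof (rule DERIV_unique)
    show "((\<lambda>t. dt f (t, s *\<^sub>R axis k 1)) has_real_derivative dt (dt f) p) (at (-1))"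
      unfolding p_def using s by (intro dt_has_derivative D) (simp)
    have "((\<lambda>t. - s / t) has_real_derivative s) (at (-1))"
      by (auto intro!: derivative_eq_intros)
    moreover have "(V has_real_derivative dx k (dx k f) p) (at (- s / (-1)))"
      using V[of s] s by (simp add: p_def)
    ultimately have "((\<lambda>t. V (- s / t)) has_real_derivative dx k (dx k f) p * s) (at (-1))"
      using DERIV_chain2 by blast
    then have "((\<lambda>t. V (- s / t) * (s / t\<^sup>2)) has_real_derivative
        s\<^sup>2 * dx k (dx k f) p + 2 * s * dx k f p) (at (-1))"
      by (auto intro!: derivative_eq_intros simp: p_def V_def power2_eq_square algebra_simps)
    then show "((\<lambda>t. dt f (t, s *\<^sub>R axis k 1)) has_real_derivative
        s\<^sup>2 * dx k (dx k f) p + 2 * s * dx k f p) (at (-1))"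
      by (rule has_field_derivative_transform_within_open[where S = "{..<- \<bar>s\<bar>}"])
        (use s dtf in auto)
  qed
qed

lemma radial_slice:
  assumes "radial U" "norm x \<le> 1" "norm x = norm y"
  shows "U (-1, x) = U (-1, y)"
proof -
  have "(-1, x) \<in> backward_lightcone" "(-1, y) \<in> backward_lightcone"
    using assms by (simp_all add: backward_lightcone_def)
  with assms show ?thesis
    unfolding radial_def by blast
qed

lemma norm_axis_orthogonal:
  assumes "j \<noteq> k"
  shows "norm (s *\<^sub>R axis k 1 + r *\<^sub>R axis j 1 :: real ^ 'n) = sqrt (s\<^sup>2 + r\<^sup>2)"
proof -
  have "orthogonal (s *\<^sub>R axis k 1) (r *\<^sub>R axis j 1 :: real ^ 'n)"
    using assms by (simp add: orthogonal_def inner_axis_axis)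
  from norm_add_Pythagorean[OF this]
  have "(norm (s *\<^sub>R axis k 1 + r *\<^sub>R axis j 1 :: real ^ 'n))\<^sup>2 = s\<^sup>2 + r\<^sup>2"
    by (simp)
  then show ?thesis
    by (metis norm_ge_zero real_sqrt_unique)
qed

text \<open>
  The source of the term \<open>(d - 1) u' / s\<close> of the radial Laplacian: each of the \<open>d - 1\<close> directions orthogonal
  to the ray contributes \<open>u' / s\<close>, because \<open>\<partial>\<^sub>j f\<close> at \<open>(-1, s e\<^sub>k + r e\<^sub>j)\<close> is \<open>u'(R) r / R\<close> with
  \<open>R = \<surd>(s\<^sup>2 + r\<^sup>2)\<close>.
\<close>
lemma dx_transversal_radial:
  fixes f :: "real \<times> (real ^ 'n) \<Rightarrow> real" and k :: 'n
  assumes C2: "Ck_on 2 backward_lightcone f"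
    and rad: "\<And>x y. norm x \<le> 1 \<Longrightarrow> norm x = norm y \<Longrightarrow> f (-1, x) = f (-1, y)"
    and s: "0 < s" "s < 1" and jk: "j \<noteq> k"
  defines "p \<equiv> (-1, s *\<^sub>R axis k 1)"
  shows "dx j f p = 0" and "s * dx j (dx j f) p = dx k f p"
proof -
  note D = C2_lightcone_D[OF C2]
  define V where "V r = dx k f (-1, r *\<^sub>R axis k 1)" for r
  have u: "((\<lambda>r. f (-1, r *\<^sub>R axis k 1)) has_real_derivative V r) (at r)" if "\<bar>r\<bar> < 1" for r
    using dx_has_derivative[OF D(1), of 0 r k "-1"] that by (simp add: V_def)
  have V: "(V has_real_derivative dx k (dx k f) (-1, r *\<^sub>R axis k 1)) (at r)" if "\<bar>r\<bar> < 1" for r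
    using dx_has_derivative[OF D(3), of 0 r k "-1" k] that by (simp add: V_def[abs_def])
  define R where "R r = sqrt (s\<^sup>2 + r\<^sup>2)" for r
  define T where "T = {r. R r < 1}"
  have R0: "R 0 = s" using s by (simp add: R_def)
  have "open T"
    unfolding T_def R_def by (intro open_Collect_less continuous_intros)
  moreover have "0 \<in> T"
    using s R0 by (simp add: T_def)
  ultimately have T: "open T" "0 \<in> T" .
  have pos: "s\<^sup>2 + r\<^sup>2 > 0" for r
    using s by (simp add: add_pos_nonneg)
  then have Rpos: "R r > 0" for r
    by (simp add: R_def)
  have dR: "(R has_real_derivative r / R r) (at r)" for r
  proof -
    have "((\<lambda>r. s\<^sup>2 + r\<^sup>2) has_real_derivative 2 * r) (at r)"
      by (auto intro!: derivative_eq_intros)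
    from DERIV_chain2[OF DERIV_real_sqrt[OF pos] this] show ?thesis
      by (simp add: R_def[abs_def] field_simps)
  qed
  have dxf: "dx j f (-1, s *\<^sub>R axis k 1 + r *\<^sub>R axis j 1) = V (R r) * (r / R r)" if r: "r \<in> T" for r
  proof (rule DERIV_unique)
    show "((\<lambda>r. f (-1, s *\<^sub>R axis k 1 + r *\<^sub>R axis j 1)) has_real_derivative
        dx j f (-1, s *\<^sub>R axis k 1 + r *\<^sub>R axis j 1)) (at r)"
      using r by (intro dx_has_derivative D) (simp add: norm_axis_orthogonal[OF jk] T_def R_def)
    have "\<bar>R r\<bar> < 1" using r Rpos[of r] by (simp add: T_def)
    from DERIV_chain2[OF u[OF this] dR]
    have "((\<lambda>r. f (-1, R r *\<^sub>R axis k 1)) has_real_derivative V (R r) * (r / R r)) (at r)" .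
    then show "((\<lambda>r. f (-1, s *\<^sub>R axis k 1 + r *\<^sub>R axis j 1)) has_real_derivative
        V (R r) * (r / R r)) (at r)"
    proof (rule has_field_derivative_transform_within_open[OF _ T(1) r])
      fix q assume "q \<in> T"
      then show "f (-1, R q *\<^sub>R axis k 1) = f (-1, s *\<^sub>R axis k 1 + q *\<^sub>R axis j 1)"
        using Rpos[of q]
        by (intro rad) (auto simp: norm_axis_orthogonal[OF jk] T_def R_def)
    qed
  qed
  from dxf[OF T(2)] show "dx j f p = 0"
    by (simp add: p_def)
  have "dx j (dx j f) p = V s / s"
  proof (rule DERIV_unique)
    show "((\<lambda>r. dx j f (-1, s *\<^sub>R axis k 1 + r *\<^sub>R axis j 1)) has_real_derivative dx j (dx j f) p) (at 0)"
      using dx_has_derivative[OF D(3), of "s *\<^sub>R axis k 1" 0 j "-1" j] s by (simp add: p_def)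
    have "(V has_real_derivative dx k (dx k f) p) (at (R 0))"
      using V[of s] s by (simp add: p_def R0)
    from DERIV_chain2[OF this dR]
    have "((\<lambda>r. V (R r)) has_real_derivative 0) (at 0)" by simp
    then have "((\<lambda>r. V (R r) * (r / R r)) has_real_derivative V s / s) (at 0)"
      using dR[of 0] Rpos[of 0]
      by (auto intro!: derivative_eq_intros simp: R0)
    then show "((\<lambda>r. dx j f (-1, s *\<^sub>R axis k 1 + r *\<^sub>R axis j 1)) has_real_derivative V s / s) (at 0)"
      by (rule has_field_derivative_transform_within_open[OF _ T]) (use dxf in auto)
  qed
  then show "s * dx j (dx j f) p = dx k f p"
    using s by (simp add: V_def p_def)
qed

section \<open>The equations on a ray and the constancy of the solution\<close>

text \<open>
  In dimension one there are no transversal directions, so both signs of \<open>s\<close> are admitted; otherwise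
  \<open>s > 0\<close> makes \<open>s\<close> the radius.
\<close>
lemma selfsimilar_profile_equation:
  fixes U :: "real \<times> (real ^ 'n) \<Rightarrow> real ^ 2" and k :: 'n
  assumes sol: "classical_solution U"
    and hom: "\<And>t x. (t, x) \<in> backward_lightcone \<Longrightarrow> U (t, x) = U (-1, x /\<^sub>R (- t))"
    and s: "\<bar>s\<bar> < 1" and "CARD('n) = 1 \<or> radial U \<and> 0 < s"
  defines "p \<equiv> (-1, s *\<^sub>R axis k 1)"
  defines "u \<equiv> \<lambda>i q. U q $ i"
  defines "E \<equiv> s * (1 - s\<^sup>2) * ((dx k (u 1) p)\<^sup>2 + (dx k (u 2) p)\<^sup>2)"
  shows "s * (1 - s\<^sup>2) * dx k (dx k (u 1)) p + (real (CARD('n) - 1) - 2 * s\<^sup>2) * dx k (u 1) p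
      + (u 1 p + u 2 p) * E = 0"
    and "s * (1 - s\<^sup>2) * dx k (dx k (u 2)) p + (real (CARD('n) - 1) - 2 * s\<^sup>2) * dx k (u 2) p
      + (u 2 p - u 1 p) * E = 0"
proof -
  have C2: "Ck_on 2 backward_lightcone (u i)" for i
    using sol by (simp add: classical_solution_def u_def)
  have p: "p \<in> backward_lightcone"
    using s by (simp add: p_def backward_lightcone_def)
  have transversal: "dx j (u i) p = 0 \<and> s * dx j (dx j (u i)) p = dx k (u i) p" if jk: "j \<noteq> k" for i j
  proof -
    have "card {j, k} \<le> CARD('n)"
      by (rule card_mono) auto
    then have "radial U" "0 < s" using assms(4) jk by auto
    have "u i (-1, x) = u i (-1, y)" if "norm x \<le> 1" "norm x = norm y" for x y
      using radial_slice[OF \<open>radial U\<close> that] by (simp only: u_def)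
    note rad = dx_transversal_radial[OF C2 this \<open>0 < s\<close> _ jk]
    from s have "s < 1" by simp
    with rad show ?thesis
      unfolding p_def by blast
  qed
  have time: "dt (u i) p = s * dx k (u i) p"
    "dt (dt (u i)) p = s\<^sup>2 * dx k (dx k (u i)) p + 2 * s * dx k (u i) p" for i
  proof -
    have "u i (t, x) = u i (-1, x /\<^sub>R (- t))" if "(t, x) \<in> backward_lightcone" for t x
      using hom[OF that] by (simp only: u_def)
    note ss = dt_selfsimilar[OF C2 this s]
    show "dt (u i) p = s * dx k (u i) p"
      "dt (dt (u i)) p = s\<^sup>2 * dx k (dx k (u i)) p + 2 * s * dx k (u i) p"
      unfolding p_def by (rule ss, assumption)+
  qed
  have lap: "s * laplacian (u i) p = s * dx k (dx k (u i)) p + real (CARD('n) - 1) * dx k (u i) p" for i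
  proof -
    have "s * laplacian (u i) p = s * dx k (dx k (u i)) p + (\<Sum>j\<in>UNIV - {k}. s * dx j (dx j (u i)) p)"
      unfolding laplacian_def
      by (subst sum.remove[of UNIV k]) (simp_all add: distrib_left sum_distrib_left)
    also have "(\<Sum>j\<in>UNIV - {k}. s * dx j (dx j (u i)) p) = (\<Sum>j\<in>UNIV - {k}. dx k (u i) p)"
      by (rule sum.cong) (use transversal in auto)
    finally show ?thesis by (simp add: card_Diff_singleton)
  qed
  have grad: "(\<Sum>j\<in>UNIV. (dx j (u i) p)\<^sup>2) = (dx k (u i) p)\<^sup>2" for i
    by (subst sum.remove[of UNIV k]) (use transversal in auto)
  have "null_form U p = (\<Sum>i\<in>UNIV. - (dt (u i) p)\<^sup>2 + (\<Sum>j\<in>UNIV. (dx j (u i) p)\<^sup>2))"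
    by (simp only: null_form_def u_def)
  then have "null_form U p = (1 - s\<^sup>2) * ((dx k (u 1) p)\<^sup>2 + (dx k (u 2) p)\<^sup>2)"
    unfolding grad time
    by (simp add: sum_2 power2_eq_square algebra_simps)
  then have E: "s * null_form U p = E"
    by (simp add: E_def mult.assoc)
  have "- dt (dt (u 1)) p + laplacian (u 1) p + (u 1 p + u 2 p) * null_form U p = 0"
    "- dt (dt (u 2)) p + laplacian (u 2) p + (u 2 p - u 1 p) * null_form U p = 0"
    using sol p by (auto simp: classical_solution_def u_def)
  then have "- s * dt (dt (u 1)) p + s * laplacian (u 1) p + (u 1 p + u 2 p) * (s * null_form U p) = 0"
    "- s * dt (dt (u 2)) p + s * laplacian (u 2) p + (u 2 p - u 1 p) * (s * null_form U p) = 0"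
    by algebra+
  then show "s * (1 - s\<^sup>2) * dx k (dx k (u 1)) p + (real (CARD('n) - 1) - 2 * s\<^sup>2) * dx k (u 1) p
      + (u 1 p + u 2 p) * E = 0"
    "s * (1 - s\<^sup>2) * dx k (dx k (u 2)) p + (real (CARD('n) - 1) - 2 * s\<^sup>2) * dx k (u 2) p
      + (u 2 p - u 1 p) * E = 0"
    unfolding lap time E by (simp_all add: algebra_simps power2_eq_square)
qed

text \<open>
  The intervals are chosen so that each has a zero of \<open>P\<close>: \<open>[-1, 0]\<close> and \<open>[0, 1]\<close> in dimension one,
  \<open>[0, b]\<close> with \<open>b < 1\<close> otherwise. They are split at \<open>0\<close>, where the profile equation degenerates.
\<close>
lemma selfsimilar_constant_on_axis:
  fixes U :: "real \<times> (real ^ 'n) \<Rightarrow> real ^ 2" and k :: 'n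
  assumes sol: "classical_solution U"
    and hom: "\<And>t x. (t, x) \<in> backward_lightcone \<Longrightarrow> U (t, x) = U (-1, x /\<^sub>R (- t))"
    and s: "\<bar>s\<bar> \<le> 1" and side: "CARD('n) = 1 \<or> radial U \<and> 0 \<le> s"
  shows "U (-1, s *\<^sub>R axis k 1) = U (-1, 0)"
proof -
  define u where "u i r = U (-1, r *\<^sub>R axis k 1) $ i" for i r
  define v where "v i r = dx k (\<lambda>q. U q $ i) (-1, r *\<^sub>R axis k 1)" for i r
  have C2: "Ck_on 2 backward_lightcone (\<lambda>q. U q $ i)" for i
    using sol by (simp add: classical_solution_def)
  define w where "w i r = dx k (dx k (\<lambda>q. U q $ i)) (-1, r *\<^sub>R axis k 1)" for i r
  note D = C2_lightcone_D[OF C2]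
  have ray: "continuous_on {-1..1} (\<lambda>r. g (-1, r *\<^sub>R axis k 1))"
    if "g differentiable_on backward_lightcone" for g :: "real \<times> (real ^ 'n) \<Rightarrow> real"
    by (rule continuous_on_compose2[OF differentiable_imp_continuous_on[OF that]])
      (auto intro!: continuous_intros simp: backward_lightcone_def)
  have cont: "continuous_on {-1..1} (u i)" "continuous_on {-1..1} (v i)" for i
    unfolding u_def[abs_def] v_def[abs_def] by (rule ray[OF D(1)], rule ray[OF D(3)])
  have du: "(u i has_real_derivative v i r) (at r)" if "\<bar>r\<bar> < 1" for i r
    using dx_has_derivative[OF D(1), of 0 r k "-1"] that by (simp add: u_def[abs_def] v_def)
  have dv: "(v i has_real_derivative w i r) (at r)" if "\<bar>r\<bar> < 1" for i r
    using dx_has_derivative[OF D(3), of 0 r k "-1" k] that by (simp add: v_def[abs_def] w_def)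
  have circle: "(u 1 r)\<^sup>2 + (u 2 r)\<^sup>2 = 1" if "\<bar>r\<bar> < 1" for r
  proof -
    have "(-1, r *\<^sub>R axis k 1) \<in> backward_lightcone"
      using that by (simp add: backward_lightcone_def)
    then have "norm (U (-1, r *\<^sub>R axis k 1)) = 1"
      using sol by (auto simp: classical_solution_def)
    then show ?thesis
      by (simp add: norm_vec_def L2_set_def sum_2 u_def)
  qed
  have flat: "v 1 r = 0 \<and> v 2 r = 0"
    if r: "r \<in> {a<..<b}" and ab: "-1 \<le> a" "b \<le> 1" "0 \<le> a \<or> b \<le> 0"
      and dim: "CARD('n) = 1 \<or> radial U \<and> 0 \<le> a"
      and bdry: "CARD('n) - 1 = 0 \<and> (-1 \<in> {a..b} \<or> 1 \<in> {a..b})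
        \<or> CARD('n) - 1 > 0 \<and> 0 \<in> {a..b} \<and> -1 < a \<and> b < 1" for r a b
  proof (rule profile_derivative_eq_0[where n = "CARD('n) - 1" and a = a and b = b
        and ?u1.0 = "u 1" and ?u2.0 = "u 2" and ?v1.0 = "v 1" and ?v2.0 = "v 2"
        and ?w1.0 = "w 1" and ?w2.0 = "w 2"])
    show "continuous_on {a..b} (u 1)" "continuous_on {a..b} (u 2)"
      "continuous_on {a..b} (v 1)" "continuous_on {a..b} (v 2)"
      using ab by (auto intro: continuous_on_subset[OF cont(1)] continuous_on_subset[OF cont(2)])
    show "{a<..<b} \<subseteq> {-1<..<1} - {0}"
      using ab by auto
    fix x assume x: "x \<in> {a<..<b}"
    then have x1: "\<bar>x\<bar> < 1" and "CARD('n) = 1 \<or> radial U \<and> 0 < x"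
      using ab dim by auto
    note eq = selfsimilar_profile_equation[OF sol hom this, of k]
    from du[OF x1] show "(u 1 has_real_derivative v 1 x) (at x)" "(u 2 has_real_derivative v 2 x) (at x)"
      by auto
    from dv[OF x1] show "(v 1 has_real_derivative w 1 x) (at x)" "(v 2 has_real_derivative w 2 x) (at x)"
      by auto
    from circle[OF x1] show "(u 1 x)\<^sup>2 + (u 2 x)\<^sup>2 = 1" .
    from eq show "x * (1 - x\<^sup>2) * w 1 x
        + (real (CARD('n) - 1) - 2 * x\<^sup>2) * v 1 x
        + (u 1 x + u 2 x) * (x * (1 - x\<^sup>2) * ((v 1 x)\<^sup>2 + (v 2 x)\<^sup>2)) = 0"
      "x * (1 - x\<^sup>2) * w 2 x
        + (real (CARD('n) - 1) - 2 * x\<^sup>2) * v 2 x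
        + (u 2 x - u 1 x) * (x * (1 - x\<^sup>2) * ((v 1 x)\<^sup>2 + (v 2 x)\<^sup>2)) = 0"
      unfolding u_def v_def w_def by blast+
  qed (use bdry r in auto)
  have flat': "v i r = 0" if r: "\<bar>r\<bar> < 1" "r \<noteq> 0" "CARD('n) = 1 \<or> radial U \<and> 0 < r" for i r
  proof -
    have "v 1 r = 0 \<and> v 2 r = 0"
    proof (cases "CARD('n) = 1")
      case True
      then show ?thesis
        using flat[of r "-1" 0] flat[of r 0 1] r by (cases "r < 0") auto
    next
      case False
      then have "CARD('n) - 1 > 0"
        using zero_less_card_finite[where 'a = 'n] by linarith
      then show ?thesis
        using flat[of r 0 "(1 + r) / 2"] r False by auto
    qed
    moreover have "i = 1 \<or> i = 2" using exhaust_2 by blast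
    ultimately show ?thesis by auto
  qed
  have "u i s = u i 0" for i
  proof (cases "s \<ge> 0")
    case True
    have "u i x = u i 0" if "0 \<le> x" "x \<le> 1" for x
    proof (rule DERIV_isconst2[of 0 1])
      show "continuous_on {0..1} (u i)"
        by (rule continuous_on_subset[OF cont(1)]) auto
      fix r :: real assume "0 < r" "r < 1"
      then show "(u i has_real_derivative 0) (at r)"
        using du[of r i] flat'[of r i] side by auto
    qed (use that in auto)
    from this[of s] True s show ?thesis by simp
  next
    case False
    then have 1: "CARD('n) = 1" using side by auto
    have *: "u i x = u i (-1)" if "-1 \<le> x" "x \<le> 0" for x
    proof (rule DERIV_isconst2[of "-1" 0])
      show "continuous_on {-1..0} (u i)"
        by (rule continuous_on_subset[OF cont(1)]) auto
      fix r :: real assume "-1 < r" "r < 0"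
      then show "(u i has_real_derivative 0) (at r)"
        using du[of r i] flat'[of r i] 1 by auto
    qed (use that in auto)
    show ?thesis using *[of s] *[of 0] False s by simp
  qed
  then show ?thesis
    by (simp add: u_def vec_eq_iff)
qed

theorem theorem1p1:
  shows "\<not> (\<exists>(U :: real \<times> (real ^ 'n::finite) \<Rightarrow> real ^ 2) (Z :: real ^ 'n \<Rightarrow> real ^ 2).
      classical_solution U \<and>
      (CARD('n) \<ge> 2 \<longrightarrow> radial U) \<and>
      \<not> U constant_on backward_lightcone \<and>
      (\<forall>y\<in>cball 0 1. Z y \<in> sphere 0 1) \<and>
      (\<forall>i. smooth_on (cball 0 1) (\<lambda>y. Z y $ i)) \<and>
      (\<forall>t x. (t, x) \<in> backward_lightcone \<longrightarrow> U (t, x) = Z (x /\<^sub>R (- t))))"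
proof clarify
  fix U :: "real \<times> (real ^ 'n) \<Rightarrow> real ^ 2" and Z :: "real ^ 'n \<Rightarrow> real ^ 2"
  assume sol: "classical_solution U" and rad: "CARD('n) \<ge> 2 \<longrightarrow> radial U"
    and nonconst: "\<not> U constant_on backward_lightcone"
    and Z: "\<forall>t x. (t, x) \<in> backward_lightcone \<longrightarrow> U (t, x) = Z (x /\<^sub>R (- t))"
  have slice: "(-1, x /\<^sub>R (- t)) \<in> backward_lightcone" if "(t, x) \<in> backward_lightcone"
    for t and x :: "real ^ 'n"
    using that by (auto simp: backward_lightcone_def field_simps)
  have hom: "U (t, x) = U (-1, x /\<^sub>R (- t))" if "(t, x) \<in> backward_lightcone" for t x
    using Z that slice[OF that] by simp
  have disc: "U (-1, y) = U (-1, 0)" if y: "norm y \<le> 1" for y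
  proof (cases "CARD('n) = 1")
    case True
    then obtain k :: 'n where k: "UNIV = {k}"
      by (metis card_1_singletonE)
    then have "y = (y $ k) *\<^sub>R axis k 1"
      by (auto simp: vec_eq_iff axis_def)
    then obtain r where r: "y = r *\<^sub>R axis k 1" ..
    have "\<bar>r\<bar> \<le> 1"
      using y by (simp add: r)
    then show ?thesis
      unfolding r using selfsimilar_constant_on_axis[OF sol hom, of r k] True by blast
  next
    case False
    moreover have "CARD('n) > 0" by simp
    ultimately have rad': "radial U" using rad by linarith
    fix k :: 'n
    have "U (-1, y) = U (-1, norm y *\<^sub>R axis k 1)"
      by (rule radial_slice[OF rad' y]) simp
    also have "\<dots> = U (-1, 0)"
      by (rule selfsimilar_constant_on_axis[OF sol hom]) (use rad' y in auto)
    finally show ?thesis .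
  qed
  have "U q = U (-1, 0)" if "q \<in> backward_lightcone" for q
  proof -
    obtain t x where q: "q = (t, x)" by fastforce
    have "norm (x /\<^sub>R (- t)) \<le> 1"
      using slice[of t x] that unfolding q by (simp add: backward_lightcone_def)
    from disc[OF this] hom[of t x] that show ?thesis
      unfolding q by (simp only:)
  qed
  then show False
    using nonconst unfolding constant_on_def by blast
qed

end
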